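(* Let $q$ be a prime power and $a,b,d,d_1,d_2,u$ positive integers with $2d\le d_1+d_2$. Then $\Lambda(q,a,b,d,u)\ge\min\{A_q(a,d_1;u),A_q(b,d_2;u)\}$.
   Context: $\Lambda(q,a,b,d,u)$ is the maximum size of a set of $a\times b$ matrices over $\mathbb{F}_q$ such that any two distinct elements $X,Y$ satisfy $\mathrm{rk}(X-Y)\ge d$ and every element has rank at most $u$. $A_q(v,d;k)$ is the maximum number of $k$-dimensional subspaces of $\mathbb{F}_q^v$ with pairwise subspace distance $\dim(U+W)-\dim(U\cap W)$ at least $d$. *)

theory Defs
  imports "HOL-Analysis.Cartesian_Space"
begin

text \<open>
  The field with \<open>q\<close> elements is a type \<open>'f\<close> of classes \<open>field\<close> and \<open>finite\<close>, where
  \<open>q = CARD('f)\<close>. An \<open>a \<times> b\<close> matrix (\<open>a\<close> rows, \<open>b\<close> columns) has type \<open>'f ^ 'b ^ 'a\<close> with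
  \<open>a = CARD('a)\<close> and \<open>b = CARD('b)\<close>; the ambient space of dimension \<open>v = CARD('v)\<close> is
  \<open>'f ^ 'v\<close>.
\<close>

definition bounded_rank_code :: "nat \<Rightarrow> nat \<Rightarrow> ('f::{field,finite} ^ 'b ^ 'a) set \<Rightarrow> bool" where
  "bounded_rank_code d u C \<longleftrightarrow>
     (\<forall>X\<in>C. \<forall>Y\<in>C. X \<noteq> Y \<longrightarrow> d \<le> rank (X - Y)) \<and> (\<forall>X\<in>C. rank X \<le> u)"

definition Lambda ::
    "'f::{field,finite} itself \<Rightarrow> 'a::finite itself \<Rightarrow> 'b::finite itself \<Rightarrow> nat \<Rightarrow> nat \<Rightarrow> nat" where
  "Lambda _ _ _ d u = Max {card C | C :: ('f ^ 'b ^ 'a) set. bounded_rank_code d u C}"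

text \<open>The subtraction does not truncate, since the intersection is contained in the sum.\<close>

definition subspace_dist :: "('f::field ^ 'v) set \<Rightarrow> ('f ^ 'v) set \<Rightarrow> nat" where
  "subspace_dist U W = vec.dim {x + y | x y. x \<in> U \<and> y \<in> W} - vec.dim (U \<inter> W)"

definition const_dim_code :: "nat \<Rightarrow> nat \<Rightarrow> ('f::{field,finite} ^ 'v) set set \<Rightarrow> bool" where
  "const_dim_code d k C \<longleftrightarrow>
     (\<forall>U\<in>C. vec.subspace U \<and> vec.dim U = k) \<and>
     (\<forall>U\<in>C. \<forall>W\<in>C. U \<noteq> W \<longrightarrow> d \<le> subspace_dist U W)"

definition A_code :: "'f::{field,finite} itself \<Rightarrow> 'v::finite itself \<Rightarrow> nat \<Rightarrow> nat \<Rightarrow> nat" where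
  "A_code _ _ d k = Max {card C | C :: ('f ^ 'v) set set. const_dim_code d k C}"

text \<open>Both maxima range over finite nonempty sets, so \<open>Max\<close> is a genuine maximum.\<close>

lemma Lambda_range_ok:
  "finite {card C | C :: ('f::{field,finite} ^ 'b::finite ^ 'a::finite) set. bounded_rank_code d u C}"
  "{card C | C :: ('f ^ 'b ^ 'a) set. bounded_rank_code d u C} \<noteq> {}"
proof -
  show "finite {card C | C :: ('f ^ 'b ^ 'a) set. bounded_rank_code d u C}"
    by simp
  have "bounded_rank_code d u ({} :: ('f ^ 'b ^ 'a) set)"
    by (simp add: bounded_rank_code_def)
  then show "{card C | C :: ('f ^ 'b ^ 'a) set. bounded_rank_code d u C} \<noteq> {}"
    by blast
qed

lemma A_code_range_ok:
  "finite {card C | C :: ('f::{field,finite} ^ 'v::finite) set set. const_dim_code d k C}"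
  "{card C | C :: ('f ^ 'v) set set. const_dim_code d k C} \<noteq> {}"
proof -
  show "finite {card C | C :: ('f ^ 'v) set set. const_dim_code d k C}"
    by simp
  have "const_dim_code d k ({} :: ('f ^ 'v) set set)"
    by (simp add: const_dim_code_def)
  then show "{card C | C :: ('f ^ 'v) set set. const_dim_code d k C} \<noteq> {}"
    by blast
qed

end

theory Submission imports Defs begin

text \<open>
  Two matrices satisfy \<open>rk A + rk B \<le> rk (A - B) + dim (col A \<inter> col B) + dim (row A \<inter> row B)\<close>:
  on the null space of \<open>A - B\<close> the matrices \<open>A\<close> and \<open>B\<close> agree, so \<open>A\<close> maps it into
  \<open>col A \<inter> col B\<close>, and the kernel of this restriction is the common null space of \<open>A\<close> and \<open>B\<close>,
  whose dimension is determined by \<open>row A + row B\<close>. Hence \<open>2 rk (A - B)\<close> is at least the sum of the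
  distances of the column spaces and of the row spaces. Any two subspaces of the same dimension are
  the column space and the row space of some matrix, so pairing the codewords of the two subspace
  codes gives the rank-metric code.
\<close>

lemma (in vector_space_pair) ex_subspace_inj_on_image_eq:
  assumes f: "Vector_Spaces.linear s1 s2 f" and V: "vs1.subspace V"
  shows "\<exists>T. vs1.subspace T \<and> T \<subseteq> V \<and> inj_on f T \<and> f ` T = f ` V"
proof -
  interpret f: Vector_Spaces.linear s1 s2 f by (fact f)
  obtain g where range_g: "range g \<subseteq> V" and g: "Vector_Spaces.linear s2 s1 g"
    and right_inverse: "\<And>y. y \<in> f ` V \<Longrightarrow> f (g y) = y"
    using linear_exists_right_inverse_on[OF f V] by blast
  interpret g: Vector_Spaces.linear s2 s1 g by (fact g)
  have "vs1.subspace (g ` f ` V)"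
    by (intro g.subspace_image f.subspace_image V)
  moreover have "g ` f ` V \<subseteq> V"
    using range_g by blast
  moreover have "inj_on f (g ` f ` V)"
    by (rule inj_on_inverseI[where g = g]) (auto simp: right_inverse)
  moreover have "f ` g ` f ` V = f ` V"
    using right_inverse by (force simp: image_image)
  ultimately show ?thesis
    by blast
qed

lemma (in finite_dimensional_vector_space_pair_1) dim_image_plus_dim_kernel:
  assumes f: "Vector_Spaces.linear s1 s2 f" and V: "vs1.subspace V"
  shows "vs2.dim (f ` V) + vs1.dim {x \<in> V. f x = 0} = vs1.dim V"
proof -
  interpret f: Vector_Spaces.linear s1 s2 f by (fact f)
  define N where "N = {x \<in> V. f x = 0}"
  have N: "vs1.subspace N"
    using vs1.subspace_inter[OF V f.subspace_kernel] by (simp add: N_def Int_def)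
  obtain T where T: "vs1.subspace T" "T \<subseteq> V" "inj_on f T" "f ` T = f ` V"
    using ex_subspace_inj_on_image_eq[OF f V] by blast
  have "V = {x + y | x y. x \<in> T \<and> y \<in> N}"
  proof
    show "V \<subseteq> {x + y | x y. x \<in> T \<and> y \<in> N}"
    proof
      fix v assume "v \<in> V"
      then obtain t where t: "t \<in> T" "f v = f t"
        using T(4) by (metis imageE imageI)
      then have "v - t \<in> N"
        using \<open>v \<in> V\<close> T(2) by (auto simp: N_def f.diff intro: vs1.subspace_diff[OF V])
      moreover have "v = t + (v - t)"
        by simp
      ultimately show "v \<in> {x + y | x y. x \<in> T \<and> y \<in> N}"
        using t(1) by blast
    qed
    show "{x + y | x y. x \<in> T \<and> y \<in> N} \<subseteq> V"
      using T(2) by (auto simp: N_def intro!: vs1.subspace_add[OF V])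
  qed
  moreover have "T \<inter> N = {0}"
    using vs1.subspace_0[OF T(1)] vs1.subspace_0[OF N] inj_onD[OF T(3)]
    by (auto simp: N_def f.zero)
  ultimately have "vs1.dim V = vs1.dim T + vs1.dim N"
    using vs1.dim_sums_Int[OF T(1) N] by simp
  moreover have "vs2.dim (f ` T) = vs1.dim T"
    using dim_image_eq[OF f, of T] T(1,3) by (simp add: vs1.span_eq_iff[THEN iffD2])
  ultimately show ?thesis
    by (simp add: N_def T(4))
qed

definition null_space :: "'f::field ^ 'n ^ 'm \<Rightarrow> ('f ^ 'n) set" where
  "null_space A = {x. A *v x = 0}"

definition row_space :: "'f::field ^ 'n ^ 'm \<Rightarrow> ('f ^ 'n) set" where
  "row_space A = vec.span (rows A)"

definition col_space :: "'f::field ^ 'n ^ 'm \<Rightarrow> ('f ^ 'm) set" where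
  "col_space A = vec.span (columns A)"

lemma subspace_row_space: "vec.subspace (row_space A)"
  by (simp add: row_space_def)

lemma subspace_col_space: "vec.subspace (col_space A)"
  by (simp add: col_space_def)

lemma col_space_transpose: "col_space (transpose A) = row_space A"
  by (simp add: row_space_def col_space_def)

lemma col_space_eq_range: "col_space A = range ((*v) A)"
proof
  have "columns A \<subseteq> range ((*v) A)"
  proof
    fix c assume "c \<in> columns A"
    then obtain j where "c = column j A"
      by (auto simp: columns_def)
    then have "c = A *v axis j 1"
      by (simp add: vec_eq_iff column_def matrix_vector_mult_def axis_def if_distrib cong: if_cong)
    then show "c \<in> range ((*v) A)"
      by blast
  qed
  then show "col_space A \<subseteq> range ((*v) A)"
    unfolding col_space_def
    by (intro vec.span_minimal vec.subspace_image vec.subspace_UNIV)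
  show "range ((*v) A) \<subseteq> col_space A"
    using matrix_vector_mult_in_columnspace_gen[of A] by (auto simp: col_space_def)
qed

lemma col_space_mult: "col_space (A ** B) = (*v) A ` col_space B"
  by (simp add: col_space_eq_range image_image matrix_vector_mul_assoc)

lemma dim_row_space: "vec.dim (row_space A) = rank A"
  by (simp add: row_space_def row_rank_def_gen)

text \<open>Expanding the rows over a basis \<open>B\<close> of the row space expresses every column as a combination
  of the \<open>card B\<close> vectors formed by the coefficients.\<close>

lemma rank_transpose_le: "rank (transpose A) \<le> rank (A :: 'f::field ^ 'n ^ 'm)"
proof -
  obtain B where B: "finite B" "vec.independent B" "vec.span B = row_space A" "card B = rank A"
    using vec.basis_subspace_exists[OF subspace_row_space] dim_row_space by metis
  define coeffs :: "'f ^ 'n \<Rightarrow> 'f ^ 'm" where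
    "coeffs b = (\<chi> i. vec.representation B (row i A) b)" for b
  have row: "row i A = (\<Sum>b\<in>B. coeffs b $ i *s b)" for i
  proof -
    have "row i A \<in> vec.span B"
      unfolding B(3) row_space_def by (rule vec.span_base) (auto simp: rows_def)
    then show ?thesis
      using vec.sum_representation_eq[OF B(2) _ B(1)] by (simp add: coeffs_def)
  qed
  have "column j A = (\<Sum>b\<in>B. b $ j *s coeffs b)" for j
    using row by (simp add: vec_eq_iff column_def row_def mult.commute)
  then have "column j A \<in> vec.span (coeffs ` B)" for j
    by (simp only:) (intro vec.span_sum vec.span_scale vec.span_base imageI)
  then have "columns A \<subseteq> vec.span (coeffs ` B)"
    by (auto simp: columns_def)
  then have "vec.dim (columns A) \<le> card (coeffs ` B)"
    using B(1) by (intro vec.dim_le_card) auto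
  also have "\<dots> \<le> rank A"
    using card_image_le[OF B(1)] B(4) by simp
  finally show ?thesis
    by (simp add: row_rank_def_gen)
qed

lemma rank_transpose_gen: "rank (transpose A) = rank (A :: 'f::field ^ 'n ^ 'm)"
  using rank_transpose_le[of A] rank_transpose_le[of "transpose A"] by simp

lemma dim_col_space: "vec.dim (col_space A) = rank A"
  using dim_row_space[of "transpose A"] by (simp add: rank_transpose_gen flip: col_space_transpose)

lemma rank_plus_dim_null_space:
  "rank A + vec.dim (null_space A) = CARD('n)" for A :: "'f::field ^ 'n ^ 'm"
  using vec.dim_image_plus_dim_kernel[OF matrix_vector_mul_linear_gen vec.subspace_UNIV, of A]
  by (simp add: null_space_def card_cart_basis flip: col_space_eq_range dim_col_space)

lemma dim_null_space_Int:
  fixes A :: "'f::field ^ 'n ^ 'm" and B :: "'f ^ 'n ^ 'k"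
  shows "rank A + rank B + vec.dim (null_space A \<inter> null_space B)
    = CARD('n) + vec.dim (row_space A \<inter> row_space B)"
proof -
  define stacked :: "'f ^ 'n ^ ('m + 'k)" where
    "stacked = (\<chi> i. case i of Inl j \<Rightarrow> A $ j | Inr j \<Rightarrow> B $ j)"
  have "rows stacked = rows A \<union> rows B"
    by (simp add: rows_def full_SetCompr_eq)
      (simp add: stacked_def row_def UNIV_sum image_Un image_image)
  then have "row_space stacked = {x + y | x y. x \<in> row_space A \<and> y \<in> row_space B}"
    by (simp add: row_space_def vec.span_Un)
  then have "rank stacked + vec.dim (row_space A \<inter> row_space B) = rank A + rank B"
    using vec.dim_sums_Int[OF subspace_row_space subspace_row_space, of A B]
    by (simp add: dim_row_space flip: dim_row_space[of stacked])
  moreover have "null_space stacked = null_space A \<inter> null_space B"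
    by (auto simp: null_space_def stacked_def vec_eq_iff matrix_vector_mult_def split: sum.split)
  ultimately show ?thesis
    using rank_plus_dim_null_space[of stacked] by simp
qed

lemma rank_plus_rank_le_rank_diff:
  fixes A B :: "'f::field ^ 'n ^ 'm"
  shows "rank A + rank B
    \<le> rank (A - B) + vec.dim (col_space A \<inter> col_space B) + vec.dim (row_space A \<inter> row_space B)"
proof -
  define H where "H = null_space (A - B)"
  have H: "x \<in> H \<longleftrightarrow> A *v x = B *v x" for x
    by (simp add: H_def null_space_def matrix_vector_mult_diff_rdistrib)
  have "vec.subspace H"
    unfolding H_def null_space_def by (rule vec.subspace_kernel)
  then have "vec.dim ((*v) A ` H) + vec.dim {x \<in> H. A *v x = 0} = vec.dim H"
    by (rule vec.dim_image_plus_dim_kernel[OF matrix_vector_mul_linear_gen])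
  moreover have "(*v) A ` H \<subseteq> range ((*v) A) \<inter> range ((*v) B)"
    using H by fastforce
  then have "vec.dim ((*v) A ` H) \<le> vec.dim (col_space A \<inter> col_space B)"
    unfolding col_space_eq_range by (rule vec.dim_subset)
  moreover have "{x \<in> H. A *v x = 0} = null_space A \<inter> null_space B"
    by (auto simp: H null_space_def)
  ultimately show ?thesis
    using rank_plus_dim_null_space[of "A - B"] dim_null_space_Int[of A B] by (simp add: H_def)
qed

lemma subspace_dist_plus_dim_Int:
  assumes "vec.subspace U" "vec.subspace W"
  shows "subspace_dist U W + 2 * vec.dim (U \<inter> W) = vec.dim U + vec.dim W"
proof -
  have "vec.dim (U \<inter> W) \<le> vec.dim U" "vec.dim (U \<inter> W) \<le> vec.dim W"
    by (simp_all add: vec.dim_subset)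
  then show ?thesis
    using vec.dim_sums_Int[OF assms] by (simp add: subspace_dist_def)
qed

lemma subspace_dist_col_row_le_rank_diff:
  fixes A B :: "'f::field ^ 'n ^ 'm"
  shows "subspace_dist (col_space A) (col_space B) + subspace_dist (row_space A) (row_space B)
    \<le> 2 * rank (A - B)"
  using rank_plus_rank_le_rank_diff[of A B]
    subspace_dist_plus_dim_Int[OF subspace_col_space subspace_col_space, of A B]
    subspace_dist_plus_dim_Int[OF subspace_row_space subspace_row_space, of A B]
  by (simp add: dim_col_space dim_row_space)

lemma ex_matrix_col_space_supported:
  fixes U :: "('f::field ^ 'm) set" and I :: "'n::finite set"
  assumes U: "vec.subspace U" and "card I = vec.dim U"
  shows "\<exists>L :: 'f ^ 'n ^ 'm. col_space L = U \<and> (\<forall>j. j \<notin> I \<longrightarrow> column j L = 0)"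
proof -
  obtain B where B: "finite B" "vec.span B = U" "card B = vec.dim U"
    using vec.basis_subspace_exists[OF U] by metis
  obtain h where h: "bij_betw h I B"
    using finite_same_card_bij[of I B] B(1,3) assms(2) by auto
  define L :: "'f ^ 'n ^ 'm" where "L = (\<chi> i j. if j \<in> I then h j $ i else 0)"
  have column: "column j L = (if j \<in> I then h j else 0)" for j
    by (simp add: L_def column_def vec_eq_iff)
  then have "columns L \<subseteq> insert 0 B" "B \<subseteq> columns L"
    using h by (auto simp: columns_def bij_betw_def)
  then have "col_space L = U"
    unfolding col_space_def
    using vec.span_mono[of "columns L" "insert 0 B"] vec.span_mono[of B "columns L"] B(2) by auto
  then show ?thesis
    using column by auto
qed

lemma col_space_mult_transpose:
  fixes L :: "'f::field ^ 'n ^ 'm" and R :: "'f ^ 'n ^ 'k"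
  assumes L: "\<And>j. j \<notin> I \<Longrightarrow> column j L = 0" and R: "\<And>j. j \<notin> I \<Longrightarrow> column j R = 0"
    and rank_R: "rank R = card I"
  shows "col_space (L ** transpose R) = col_space L"
proof -
  define E :: "('f ^ 'n) set" where "E = {x. \<forall>j. j \<notin> I \<longrightarrow> x $ j = 0}"
  have "col_space (transpose R) = E"
  proof (rule vec.subspace_dim_equal)
    show "vec.subspace E"
      by (auto simp: E_def vec.subspace_def)
    show "col_space (transpose R) \<subseteq> E"
      using R by (auto simp: E_def col_space_eq_range matrix_vector_mult_def transpose_def
          column_def vec_eq_iff)
    show "vec.dim E \<le> vec.dim (col_space (transpose R))"
      by (simp add: E_def dim_substandard_cart dim_col_space rank_transpose_gen rank_R)
  qed (rule subspace_col_space)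
  then have "col_space (L ** transpose R) = (*v) L ` E"
    by (simp only: col_space_mult)
  also have "\<dots> = col_space L"
  proof -
    have "L *v x = L *v (\<chi> j. if j \<in> I then x $ j else 0)" for x
      unfolding matrix_mult_sum using L by (intro sum.cong) auto
    then show ?thesis
      unfolding col_space_eq_range E_def by force
  qed
  finally show ?thesis .
qed

lemma ex_matrix_col_space_row_space:
  fixes U :: "('f::field ^ 'm) set" and W :: "('f ^ 'k) set"
  assumes "vec.subspace U" "vec.subspace W" "vec.dim U = vec.dim W"
  shows "\<exists>X :: 'f ^ 'k ^ 'm. col_space X = U \<and> row_space X = W"
proof -
  have "vec.dim U \<le> CARD('m)"
    by (rule dim_subset_UNIV_cart_gen)
  then obtain I :: "'m set" where I: "card I = vec.dim U"
    using obtain_subset_with_card_n by blast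
  obtain L :: "'f ^ 'm ^ 'm" where
    L: "col_space L = U" "\<And>j. j \<notin> I \<Longrightarrow> column j L = 0"
    using ex_matrix_col_space_supported[OF assms(1) I] by blast
  obtain R :: "'f ^ 'm ^ 'k" where
    R: "col_space R = W" "\<And>j. j \<notin> I \<Longrightarrow> column j R = 0"
    using ex_matrix_col_space_supported[OF assms(2)] I assms(3) by metis
  have "rank L = card I" "rank R = card I"
    using L(1) R(1) I assms(3) by (simp_all flip: dim_col_space)
  then have "col_space (L ** transpose R) = U" "col_space (R ** transpose L) = W"
    using col_space_mult_transpose[OF L(2) R(2)] col_space_mult_transpose[OF R(2) L(2)] L(1) R(1)
    by simp_all
  moreover have "R ** transpose L = transpose (L ** transpose R)"
    by (simp add: matrix_transpose_mul)
  ultimately show ?thesis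
    by (metis col_space_transpose)
qed

lemma bounded_rank_code_if_const_dim_codes:
  assumes "const_dim_code d\<^sub>1 u (col_space ` M)" "inj_on col_space M"
    and "const_dim_code d\<^sub>2 u (row_space ` M)" "inj_on row_space M"
    and "2 * d \<le> d\<^sub>1 + d\<^sub>2"
  shows "bounded_rank_code d u M"
  unfolding bounded_rank_code_def
proof (intro conjI ballI impI)
  fix X Y assume "X \<in> M" "Y \<in> M" "X \<noteq> Y"
  then have "d\<^sub>1 \<le> subspace_dist (col_space X) (col_space Y)"
    and "d\<^sub>2 \<le> subspace_dist (row_space X) (row_space Y)"
    using assms(1-4) by (auto simp: const_dim_code_def inj_on_eq_iff)
  then show "d \<le> rank (X - Y)"
    using subspace_dist_col_row_le_rank_diff[of X Y] assms(5) by linarith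
next
  fix X assume "X \<in> M"
  then show "rank X \<le> u"
    using assms(1) by (auto simp: const_dim_code_def dim_col_space)
qed

lemma const_dim_code_subset: "const_dim_code d k C \<Longrightarrow> D \<subseteq> C \<Longrightarrow> const_dim_code d k D"
  unfolding const_dim_code_def by blast

lemma ex_bounded_rank_code:
  fixes C :: "('f::{field,finite} ^ 'a) set set" and D :: "('f ^ 'b) set set"
  assumes C: "const_dim_code d\<^sub>1 u C" and D: "const_dim_code d\<^sub>2 u D" and "2 * d \<le> d\<^sub>1 + d\<^sub>2"
  shows "\<exists>M :: ('f ^ 'b ^ 'a) set. bounded_rank_code d u M \<and> card M = min (card C) (card D)"
proof -
  obtain S where S: "S \<subseteq> C" "card S = min (card C) (card D)"
    using obtain_subset_with_card_n[of "min (card C) (card D)" C] by auto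
  obtain p where p: "p ` S \<subseteq> D" "inj_on p S"
    using card_le_inj[of S D] S(2) by auto
  have "\<exists>X :: 'f ^ 'b ^ 'a. col_space X = U \<and> row_space X = p U" if "U \<in> S" for U
  proof (rule ex_matrix_col_space_row_space)
    have "U \<in> C" "p U \<in> D"
      using that S(1) p(1) by auto
    then show "vec.subspace U" "vec.subspace (p U)" "vec.dim U = vec.dim (p U)"
      using C D by (simp_all add: const_dim_code_def)
  qed
  then obtain X :: "('f ^ 'a) set \<Rightarrow> 'f ^ 'b ^ 'a" where
    X: "\<And>U. U \<in> S \<Longrightarrow> col_space (X U) = U" "\<And>U. U \<in> S \<Longrightarrow> row_space (X U) = p U"
    by metis
  have "bounded_rank_code d u (X ` S)"
  proof (rule bounded_rank_code_if_const_dim_codes)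
    have "col_space ` X ` S = S" "row_space ` X ` S = p ` S"
      by (simp_all add: image_image X cong: image_cong_simp)
    then show "const_dim_code d\<^sub>1 u (col_space ` X ` S)" "const_dim_code d\<^sub>2 u (row_space ` X ` S)"
      using const_dim_code_subset[OF C S(1)] const_dim_code_subset[OF D p(1)] by simp_all
    show "inj_on col_space (X ` S)" "inj_on row_space (X ` S)"
      using p(2) by (auto simp: inj_on_def X)
  qed fact
  moreover have "inj_on X S"
    using X(1) by (rule inj_on_inverseI)
  ultimately show ?thesis
    using S(2) by (auto simp: card_image)
qed

lemma A_code_attained:
  "\<exists>C :: ('f::{field,finite} ^ 'v) set set.
    const_dim_code d k C \<and> card C = A_code TYPE('f) TYPE('v) d k"
  using Max_in[OF A_code_range_ok[where 'f='f and 'v='v and d=d and k=k]]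
  unfolding A_code_def by auto

lemma card_le_Lambda:
  fixes M :: "('f::{field,finite} ^ 'b ^ 'a) set"
  assumes "bounded_rank_code d u M"
  shows "card M \<le> Lambda TYPE('f) TYPE('a) TYPE('b) d u"
  unfolding Lambda_def using assms by (intro Max_ge Lambda_range_ok) auto

theorem theorem15:
  fixes d d\<^sub>1 d\<^sub>2 u :: nat
  assumes "d > 0" and "d\<^sub>1 > 0" and "d\<^sub>2 > 0" and "u > 0"
    and "2 * d \<le> d\<^sub>1 + d\<^sub>2"
  shows "Lambda TYPE('f::{field,finite}) TYPE('a::finite) TYPE('b::finite) d u
    \<ge> min (A_code TYPE('f) TYPE('a) d\<^sub>1 u) (A_code TYPE('f) TYPE('b) d\<^sub>2 u)"
proof -
  obtain C :: "('f ^ 'a) set set" where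
    C: "const_dim_code d\<^sub>1 u C" "card C = A_code TYPE('f) TYPE('a) d\<^sub>1 u"
    using A_code_attained by blast
  obtain D :: "('f ^ 'b) set set" where
    D: "const_dim_code d\<^sub>2 u D" "card D = A_code TYPE('f) TYPE('b) d\<^sub>2 u"
    using A_code_attained by blast
  obtain M :: "('f ^ 'b ^ 'a) set" where
    "bounded_rank_code d u M" "card M = min (card C) (card D)"
    using ex_bounded_rank_code[OF C(1) D(1) assms(5)] by blast
  then show ?thesis
    using card_le_Lambda C(2) D(2) by metis
qed

end
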